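(* Let $V$ be a finite-dimensional real vector space with $\dim V\ge 8$. Then there exists $T\in C^4V^*=S^2(\Lambda^4V^* )$ such that $T_{[i_1\dots i_5j_1j_2j_3]}=0$ (for all indices) but $T_{[i_1\dots i_5]j_1j_2j_3}\neq 0$ (as a tensor).
   Context: $C^rV^*=S^2(\Lambda^rV^* )$ is the space of elements of $\Lambda^rV^*\otimes\Lambda^rV^*$ fixed by interchanging the two tensor factors. An element $T\in C^4V^*$ is regarded as an 8-linear form on $V$ with components $T_{i_1i_2i_3i_4j_1j_2j_3j_4}$, alternating in the first four and in the last four arguments, and symmetric under interchanging the first group of four arguments with the last. Square brackets denote antisymmetrization over the enclosed $m$ indices: $T_{[i_1\dots i_m]\dots}=\frac1{m!}\sum_{\sigma\in S_m}(-1)^\sigma T_{i_{\sigma(1)}\dots i_{\sigma(m)}\dots}$. *)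

theory Defs
  imports Complex_Main "HOL-Library.Numeral_Type" "HOL-Combinatorics.Permutations"
begin

definition multilinear :: "(('n \<Rightarrow> 'v::real_vector) \<Rightarrow> real) \<Rightarrow> bool" where
  "multilinear T \<longleftrightarrow> (\<forall>x i. linear (\<lambda>v. T (x(i := v))))"

definition alternating_in :: "'n set \<Rightarrow> (('n \<Rightarrow> 'v) \<Rightarrow> real) \<Rightarrow> bool" where
  "alternating_in S T \<longleftrightarrow> (\<forall>x. \<forall>i\<in>S. \<forall>j\<in>S. i \<noteq> j \<longrightarrow> x i = x j \<longrightarrow> T x = 0)"

definition antisymmetrize :: "'n set \<Rightarrow> (('n \<Rightarrow> 'v) \<Rightarrow> real) \<Rightarrow> ('n \<Rightarrow> 'v) \<Rightarrow> real" where
  "antisymmetrize S T x =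
     (1 / fact (card S)) * (\<Sum>p | p permutes S. of_int (sign p) * T (x \<circ> p))"

text \<open>
  An 8-linear form on \<open>V\<close> takes its arguments as a family indexed by the 8-element type \<open>8\<close>:
  positions \<open>0, 1, 2, 3\<close> carry the indices \<open>i\<^sub>1, \<dots>, i\<^sub>4\<close> and positions \<open>4, 5, 6, 7\<close> the indices
  \<open>j\<^sub>1, \<dots>, j\<^sub>4\<close>. Arithmetic in \<open>8\<close> is modulo 8, so \<open>\<lambda>k. k + 4\<close> interchanges the two groups.
  The set below is the space \<open>C\<^sup>4V\<^sup>* = S\<^sup>2(\<Lambda>\<^sup>4V\<^sup>*)\<close>, viewed as a space of 8-linear forms.
\<close>

definition C4 :: "((8 \<Rightarrow> 'v::real_vector) \<Rightarrow> real) set" where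
  "C4 = {T. multilinear T \<and>
            alternating_in {0, 1, 2, 3} T \<and>
            alternating_in {4, 5, 6, 7} T \<and>
            (\<forall>x. T (\<lambda>k. x (k + 4)) = T x)}"

end

theory Submission
  imports Defs
begin

text \<open>
  Under the general linear group, \<open>S\<^sup>2(\<Lambda>\<^sup>4V\<^sup>*)\<close> is the sum of the irreducible representations whose
  Young diagrams have two columns, of lengths \<open>(4, 4)\<close>, \<open>(6, 2)\<close> and \<open>(8, 0)\<close>. Antisymmetrizing over
  five arguments kills only the first summand, while antisymmetrizing over all eight kills the first
  two; so a tensor with a nonzero \<open>(6, 2)\<close> part and no \<open>(8, 0)\<close> part has the required properties.

  A concrete one is the symmetric product \<open>\<alpha> \<odot> \<beta>\<close> of two decomposable 4-forms with exactly one common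
  factor,
  \<open>\<alpha> = c\<^sub>0 \<and> c\<^sub>1 \<and> c\<^sub>2 \<and> c\<^sub>3\<close> and \<open>\<beta> = c\<^sub>0 \<and> c\<^sub>5 \<and> c\<^sub>6 \<and> c\<^sub>7\<close>, for coordinate functionals \<open>c\<^sub>k\<close>. Its total
  antisymmetrization is a multiple of \<open>\<alpha> \<and> \<beta>\<close>, which vanishes because \<open>c\<^sub>0\<close> occurs twice. Its
  antisymmetrization over five arguments contains \<open>(\<alpha> \<and> c\<^sub>5) \<otimes> (c\<^sub>0 \<and> c\<^sub>6 \<and> c\<^sub>7)\<close>, which no other
  term cancels.

  To avoid expanding determinants, \<open>\<alpha> \<odot> \<beta>\<close> is written as the signed sum of a single product of
  functionals over the group \<open>G\<close> of all permutations of the eight positions that preserve the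
  partition into the two groups of four. The sign is the right character of \<open>G\<close>, since interchanging
  the two groups is a product of four transpositions and hence even. Membership in \<open>S\<^sup>2(\<Lambda>\<^sup>4V\<^sup>*)\<close> is then
  the equivariance of signed sums under \<open>G\<close> (\<open>signed_sum_comp\<close>), the vanishing of the total
  antisymmetrization is the cancellation under the transposition of the two positions that carry
  \<open>c\<^sub>0\<close> (\<open>signed_sum_invariant_eq_0\<close>), and the nonvanishing holds because on a suitable
  family of basis vectors every nonzero term has the same sign (\<open>factorization_unique\<close>).
\<close>

section \<open>Signed sums over sets of permutations\<close>

definition signed_sum :: "('n \<Rightarrow> 'n) set \<Rightarrow> (('n \<Rightarrow> 'v) \<Rightarrow> real) \<Rightarrow> ('n \<Rightarrow> 'v) \<Rightarrow> real" where
  "signed_sum H F x = (\<Sum>p\<in>H. of_int (sign p) * F (x \<circ> p))"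

lemma antisymmetrize_eq_signed_sum:
  "antisymmetrize S T x = signed_sum {p. p permutes S} T x / fact (card S)"
  by (simp add: antisymmetrize_def signed_sum_def)

lemma permutation_of_bij: "bij p \<Longrightarrow> permutation p" for p :: "'n::finite \<Rightarrow> 'n"
  by (simp add: permutation)

text \<open>The sum over \<open>H\<close> is reindexed by left translation with \<open>q\<close>.\<close>

lemma signed_sum_comp:
  fixes H :: "('n::finite \<Rightarrow> 'n) set"
  assumes H: "\<And>p. p \<in> H \<Longrightarrow> bij p" and q: "bij q" and qH: "\<And>p. q \<circ> p \<in> H \<longleftrightarrow> p \<in> H"
  shows "signed_sum H F (x \<circ> q) = of_int (sign q) * signed_sum H F x"
proof -
  have inv: "q \<circ> (inv q \<circ> p) = p" "inv q \<circ> (q \<circ> p) = p" for p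
    using q by (simp_all add: fun_eq_iff bij_is_inj bij_is_surj surj_f_inv_f)
  have "signed_sum H F x = (\<Sum>p\<in>H. of_int (sign (q \<circ> p)) * F (x \<circ> (q \<circ> p)))"
    unfolding signed_sum_def
    by (rule sum.reindex_bij_witness[of _ "\<lambda>p. q \<circ> p" "\<lambda>p. inv q \<circ> p"])
      (use qH inv in metis)+
  also have "\<dots> = of_int (sign q) * signed_sum H F (x \<circ> q)"
    unfolding signed_sum_def sum_distrib_left
    using H q by (intro sum.cong) (simp_all add: sign_compose permutation_of_bij comp_assoc)
  finally show ?thesis
    by (simp add: sign_def)
qed

text \<open>Right translation by \<open>t\<close> maps the sum to its negative.\<close>

lemma signed_sum_invariant_eq_0:
  fixes F :: "('n::finite \<Rightarrow> 'v) \<Rightarrow> real"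
  assumes t: "bij t" "sign t = -1" and inv: "\<And>y. F (y \<circ> t) = F y"
  shows "signed_sum {p. bij p} F x = 0"
proof -
  have tt: "(p \<circ> inv t) \<circ> t = p" "(p \<circ> t) \<circ> inv t = p" for p :: "'n \<Rightarrow> 'n"
    using t(1) by (simp_all add: fun_eq_iff bij_is_inj bij_is_surj surj_f_inv_f)
  have "signed_sum {p. bij p} F x = (\<Sum>p | bij p. of_int (sign (p \<circ> t)) * F (x \<circ> (p \<circ> t)))"
    unfolding signed_sum_def
    by (rule sum.reindex_bij_witness[of _ "\<lambda>p. p \<circ> t" "\<lambda>p. p \<circ> inv t"])
      (use t(1) in \<open>auto simp: tt bij_comp bij_imp_bij_inv\<close>)
  also have "\<dots> = - signed_sum {p. bij p} F x"
    unfolding signed_sum_def sum_negf[symmetric]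
    using t by (intro sum.cong)
      (simp_all add: sign_compose permutation_of_bij inv comp_assoc[symmetric])
  finally show ?thesis by simp
qed

lemma signed_sum_nested:
  fixes H :: "('n::finite \<Rightarrow> 'n) set"
  shows "signed_sum K (signed_sum H F) x =
    (\<Sum>p\<in>K. \<Sum>q\<in>H. of_int (sign p * sign q) * F (x \<circ> (p \<circ> q)))"
  by (simp add: signed_sum_def sum_distrib_left comp_assoc mult.assoc)

text \<open>For each fixed element of \<open>H\<close>, right translation by it reindexes the outer sum and its two
  signs cancel, so the element contributes the full signed sum of \<open>F\<close>.\<close>

lemma signed_sum_signed_sum:
  fixes H :: "('n::finite \<Rightarrow> 'n) set"
  assumes H: "\<And>p. p \<in> H \<Longrightarrow> bij p"
  shows "signed_sum {p. bij p} (signed_sum H F) x = card H * signed_sum {p. bij p} F x"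
proof -
  have right_translate: "(\<Sum>p | bij p. of_int (sign p * sign q) * F (x \<circ> (p \<circ> q))) = signed_sum {p. bij p} F x"
    if "q \<in> H" for q
  proof -
    have q: "bij q" using H that by simp
    have qq: "(p \<circ> inv q) \<circ> q = p" "(p \<circ> q) \<circ> inv q = p" for p :: "'n \<Rightarrow> 'n"
      using q by (simp_all add: fun_eq_iff bij_is_inj bij_is_surj surj_f_inv_f)
    show ?thesis
      unfolding signed_sum_def
      by (rule sum.reindex_bij_witness[of _ "\<lambda>p. p \<circ> inv q" "\<lambda>p. p \<circ> q"])
        (use q in \<open>auto simp: qq bij_comp bij_imp_bij_inv sign_compose permutation_of_bij\<close>)
  qed
  show ?thesis
    unfolding signed_sum_nested
    by (subst sum.swap) (simp only: right_translate sum_constant cong: sum.cong)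
qed

lemma permutes_UNIV_iff_bij: "p permutes UNIV \<longleftrightarrow> bij p"
  by (auto simp: permutes_univ bij_iff)

section \<open>Products of linear functionals\<close>

lemma linear_const_mult:
  fixes f :: "'v::real_vector \<Rightarrow> real"
  shows "linear f \<Longrightarrow> linear (\<lambda>v. a * f v)"
  using linear_compose_scale_right[of f a] by simp

definition tensor_product :: "('n \<Rightarrow> 'v \<Rightarrow> real) \<Rightarrow> ('n::finite \<Rightarrow> 'v) \<Rightarrow> real" where
  "tensor_product f x = (\<Prod>k\<in>UNIV. f k (x k))"

lemma multilinear_tensor_product:
  fixes f :: "'n::finite \<Rightarrow> 'v::real_vector \<Rightarrow> real"
  assumes "\<And>k. linear (f k)"
  shows "multilinear (tensor_product f)"
  unfolding multilinear_def
proof (intro allI)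
  fix x :: "'n \<Rightarrow> 'v" and i
  have "tensor_product f (x(i := v)) = (\<Prod>k\<in>UNIV - {i}. f k (x k)) * f i v" for v
    unfolding tensor_product_def
    by (subst prod.remove[of _ i]) (simp_all cong: prod.cong_simp)
  then show "linear (\<lambda>v. tensor_product f (x(i := v)))"
    using assms[of i] by (simp add: linear_const_mult)
qed

lemma multilinear_signed_sum:
  assumes H: "\<And>p. p \<in> H \<Longrightarrow> bij p" and F: "multilinear F"
  shows "multilinear (signed_sum H F)"
  unfolding multilinear_def
proof (intro allI)
  fix x :: "'a \<Rightarrow> 'b" and i
  have "linear (\<lambda>v. of_int (sign p) * F (x(i := v) \<circ> p))" if "p \<in> H" for p
  proof -
    have p: "bij p" using H that by simp
    have "x(i := v) \<circ> p = (x \<circ> p)(inv p i := v)" for v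
      using p by (auto simp: fun_eq_iff bij_is_inj bij_is_surj surj_f_inv_f)
    then show ?thesis
      using F by (simp add: multilinear_def linear_const_mult)
  qed
  then show "linear (\<lambda>v. signed_sum H F (x(i := v)))"
    unfolding signed_sum_def by (intro linear_compose_sum) simp
qed

lemma tensor_product_comp_invariant:
  assumes "bij t" and "\<And>k. f (t k) = f k"
  shows "tensor_product f (x \<circ> t) = tensor_product f x"
proof -
  have "(\<Prod>k\<in>UNIV. f k (x (t k))) = (\<Prod>k\<in>UNIV. f (t k) (x (t k)))"
    by (simp add: assms(2))
  also have "\<dots> = (\<Prod>k\<in>UNIV. f k (x k))"
    using assms(1) by (rule prod.reindex_bij_betw)
  finally show ?thesis by (simp add: tensor_product_def)
qed

lemma tensor_product_dual_basis:
  assumes "\<And>i j. c i (e j) = of_bool (i = j)"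
  shows "tensor_product (\<lambda>k. c (w k)) (\<lambda>k. e (v k)) = of_bool (\<forall>k. v k = w k)"
proof (cases "\<forall>k. v k = w k")
  case False
  then obtain k where "c (w k) (e (v k)) = 0"
    using assms by fastforce
  with False show ?thesis
    by (auto simp: tensor_product_def intro!: prod_zero)
qed (simp add: tensor_product_def assms)

section \<open>Permutations preserving the two groups of four positions\<close>

definition block_perms :: "(8 \<Rightarrow> 8) set" where
  "block_perms = {p. bij p \<and>
    (\<forall>i j. (p i \<in> {0, 1, 2, 3} \<longleftrightarrow> p j \<in> {0, 1, 2, 3}) \<longleftrightarrow> (i \<in> {0, 1, 2, 3} \<longleftrightarrow> j \<in> {0, 1, 2, 3}))}"

lemma UNIV_8: "(UNIV :: 8 set) = {0, 1, 2, 3, 4, 5, 6, 7}"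
  by (rule sym, rule card_seteq) simp_all

lemma all_8: "(\<forall>k::8. P k) \<longleftrightarrow> P 0 \<and> P 1 \<and> P 2 \<and> P 3 \<and> P 4 \<and> P 5 \<and> P 6 \<and> P 7"
proof -
  have "(\<forall>k. P k) \<longleftrightarrow> (\<forall>k\<in>UNIV. P k)" by simp
  then show ?thesis unfolding UNIV_8 by simp
qed

lemma bij_block_perms: "p \<in> block_perms \<Longrightarrow> bij p"
  by (simp add: block_perms_def)

lemma block_permsD:
  assumes "p \<in> block_perms"
  shows "(p i \<in> {0, 1, 2, 3} \<longleftrightarrow> p j \<in> {0, 1, 2, 3}) \<longleftrightarrow> (i \<in> {0, 1, 2, 3} \<longleftrightarrow> j \<in> {0, 1, 2, 3})"
  using assms unfolding block_perms_def mem_Collect_eq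
  by (elim conjE) (drule spec, erule spec)

lemma block_perms_comp_iff:
  assumes "q \<in> block_perms"
  shows "q \<circ> p \<in> block_perms \<longleftrightarrow> p \<in> block_perms"
proof -
  have q: "bij q" using assms by (rule bij_block_perms)
  have "bij (q \<circ> p) \<longleftrightarrow> bij p"
  proof
    assume "bij (q \<circ> p)"
    then have "bij (inv q \<circ> (q \<circ> p))"
      using q by (blast intro: bij_comp bij_imp_bij_inv)
    moreover have "inv q \<circ> (q \<circ> p) = p"
      using q by (simp add: fun_eq_iff bij_is_inj)
    ultimately show "bij p" by simp
  qed (use q in \<open>auto intro: bij_comp\<close>)
  then show ?thesis
    using assms by (simp only: block_perms_def mem_Collect_eq comp_apply)
qed

lemma transpose_in_block_perms:
  assumes "i \<in> {0, 1, 2, 3} \<longleftrightarrow> j \<in> {0, 1, 2, 3}"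
  shows "transpose i j \<in> block_perms"
proof -
  have "transpose i j k \<in> {0, 1, 2, 3} \<longleftrightarrow> k \<in> {0, 1, 2, 3}" for k
    using assms by (simp only: transpose_def split: if_split) blast
  moreover have "bij (transpose i j)" by simp
  ultimately show ?thesis
    by (simp only: block_perms_def mem_Collect_eq simp_thms)
qed

lemma add_4_eq_transpose:
  "(\<lambda>k::8. k + 4) = transpose 0 4 \<circ> transpose 1 5 \<circ> transpose 2 6 \<circ> transpose 3 7"
  unfolding fun_eq_iff all_8 by (simp add: transpose_def)

lemma sign_add_4: "sign (\<lambda>k::8. k + 4) = 1"
  unfolding add_4_eq_transpose
  by (simp add: sign_compose permutation_compose permutation_swap_id sign_swap_id)

lemma add_4_in_block_perms: "(\<lambda>k::8. k + 4) \<in> block_perms"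
proof -
  have "bij (\<lambda>k::8. k + 4)"
    unfolding add_4_eq_transpose by (intro bij_comp) simp_all
  moreover have "\<forall>k::8. k + 4 \<in> {0, 1, 2, 3} \<longleftrightarrow> k \<notin> {0, 1, 2, 3}"
    unfolding all_8 by simp
  ultimately show ?thesis
    unfolding block_perms_def mem_Collect_eq by blast
qed

text \<open>Transpositions within a group and the interchange of the groups all lie in the group of
  permutations that is summed over, so equivariance gives both alternation and symmetry.\<close>

lemma signed_sum_block_perms_in_C4:
  fixes F :: "(8 \<Rightarrow> 'v::real_vector) \<Rightarrow> real"
  assumes "multilinear F"
  shows "signed_sum block_perms F \<in> C4"
proof -
  let ?T = "signed_sum block_perms F"
  have comp: "?T (x \<circ> q) = of_int (sign q) * ?T x" if "q \<in> block_perms" for q x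
    using that by (intro signed_sum_comp) (simp_all add: bij_block_perms block_perms_comp_iff)
  have alt: "?T x = 0"
    if "i \<noteq> j" "x i = x j" "i \<in> {0, 1, 2, 3} \<longleftrightarrow> j \<in> {0, 1, 2, 3}" for i j x
  proof -
    have "x \<circ> transpose i j = x"
      using that(2) by (auto simp: fun_eq_iff transpose_def)
    then have "?T x = - ?T x"
      using comp[OF transpose_in_block_perms, of i j x] that by (simp add: sign_swap_id)
    then show ?thesis by simp
  qed
  have "multilinear ?T"
    using bij_block_perms assms by (rule multilinear_signed_sum)
  moreover have "alternating_in {0, 1, 2, 3} ?T"
    unfolding alternating_in_def by (blast intro: alt)
  moreover have "alternating_in {4, 5, 6, 7} ?T"
    unfolding alternating_in_def
  proof (intro allI ballI impI)
    fix x :: "8 \<Rightarrow> 'v" and i j :: 8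
    assume ij: "i \<in> {4, 5, 6, 7}" "j \<in> {4, 5, 6, 7}" "i \<noteq> j" "x i = x j"
    then have "i \<notin> {0, 1, 2, 3}" "j \<notin> {0, 1, 2, 3}" by auto
    with ij show "?T x = 0" by (blast intro: alt)
  qed
  moreover have "?T (\<lambda>k. x (k + 4)) = ?T x" for x
    using comp[OF add_4_in_block_perms, of x] by (simp add: sign_add_4 comp_def)
  ultimately show ?thesis
    by (simp add: C4_def)
qed

section \<open>The tensor\<close>

text \<open>Position \<open>k\<close> carries the functional with index \<open>labels k\<close>: the two groups of positions give the
  factors of \<open>\<alpha>\<close> and of \<open>\<beta>\<close>.\<close>

definition labels :: "8 \<Rightarrow> 8" where
  "labels = id(4 := 0)"

text \<open>The five-fold antisymmetrization is evaluated on basis vectors labelled by \<open>labels\<close> with positions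
  \<open>4\<close> and \<open>5\<close> interchanged; otherwise \<open>e 0\<close> would occur twice among the five arguments. The
  equation below characterizes the nonzero terms. It determines \<open>p \<circ> g\<close> up to composition with the
  transposition of the positions \<open>0\<close> and \<open>4\<close>, which carry the same label. The unwanted possibility would
  force \<open>g 0 = 5\<close> and \<open>g 6 = 6\<close>, as \<open>p\<close> fixes \<open>5\<close> and \<open>6\<close>, so that \<open>g\<close> would move two positions
  of different groups into the same group.\<close>

lemma factorization_unique:
  assumes p: "p permutes {0, 1, 2, 3, 4}" and g: "g \<in> block_perms"
    and eq: "\<And>k. labels (transpose 4 5 (p (g k))) = labels k"
  shows "p \<circ> g = transpose 4 5"
proof -
  define r where "r = transpose 4 5 \<circ> (p \<circ> g)"
  have pg: "p (g k) = transpose 4 5 (r k)" for k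
    by (simp add: r_def)
  have "inj r"
    unfolding r_def using p g
    by (intro inj_compose) (auto simp: permutes_inj bij_block_perms bij_is_inj)
  have lab: "labels (r k) = labels k" for k
    using eq by (simp add: r_def)
  have fix_others: "r k = k" if "k \<noteq> 0" "k \<noteq> 4" for k
    using lab[of k] that by (auto simp: labels_def split: if_splits)
  have r04: "r 0 \<in> {0, 4}" "r 4 \<in> {0, 4}"
    using lab[of 0] lab[of 4] by (auto simp: labels_def split: if_splits)
  have "r 0 \<noteq> 4"
  proof
    assume "r 0 = 4"
    then have "p (g 0) = p 5"
      using pg[of 0] permutes_not_in[OF p, of 5] by simp
    moreover have "p (g 6) = p 6"
      using pg[of 6] permutes_not_in[OF p, of 6] fix_others[of 6] by simp
    ultimately have "g 0 = 5" "g 6 = 6"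
      using permutes_inj[OF p] by (auto dest: injD)
    moreover have "(g 0 \<in> {0, 1, 2, 3} \<longleftrightarrow> g 6 \<in> {0, 1, 2, 3}) \<longleftrightarrow>
        ((0::8) \<in> {0, 1, 2, 3} \<longleftrightarrow> (6::8) \<in> {0, 1, 2, 3})"
      using g by (rule block_permsD)
    ultimately show False by simp
  qed
  then have "r 0 = 0" using r04 by simp
  moreover have "r 4 = 4"
    using r04 \<open>r 0 = 0\<close> injD[OF \<open>inj r\<close>, of 4 0] by auto
  ultimately have "r k = k" for k
    using fix_others[of k] by metis
  then show ?thesis
    using pg by auto
qed

text \<open>All nonzero terms have the sign of the transposition of \<open>4\<close> and \<open>5\<close>, so they cannot cancel; the
  pair of the identity and this transposition contributes such a term.\<close>

lemma five_fold_antisymmetrization_nonzero: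
  assumes dual: "\<And>i j :: 8. c i (e j) = of_bool (i = j)"
  shows "signed_sum {p. p permutes {0, 1, 2, 3, 4}}
    (signed_sum block_perms (tensor_product (\<lambda>k. c (labels k))))
    (\<lambda>k. e (labels (transpose 4 5 k))) < 0"
proof -
  let ?P = "{p. p permutes {0, 1, 2, 3, 4 :: 8}}"
  define F where "F = tensor_product (\<lambda>k. c (labels k))"
  define x where "x = (\<lambda>k. e (labels (transpose 4 5 k)))"
  define summand where "summand = (\<lambda>(p, g). real_of_int (sign p * sign g) * F (x \<circ> (p \<circ> g)))"
  have F: "F (x \<circ> (p \<circ> g)) = of_bool (\<forall>k. labels (transpose 4 5 (p (g k))) = labels k)" for p g
    unfolding F_def x_def comp_def by (rule tensor_product_dual_basis[of c e, OF dual])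
  have "summand (p, g) \<le> 0" if p: "p \<in> ?P" and g: "g \<in> block_perms" for p g
  proof (cases "\<forall>k. labels (transpose 4 5 (p (g k))) = labels k")
    case True
    then have "p \<circ> g = transpose 4 5"
      using factorization_unique p g by blast
    then have "sign p * sign g = -1"
      using sign_compose[of p g] p g
      by (simp add: permutation_of_bij bij_block_perms permutes_bij sign_swap_id)
    then show ?thesis
      by (simp add: summand_def F flip: of_int_mult)
  next
    case False
    then have "F (x \<circ> (p \<circ> g)) = 0"
      by (simp only: F of_bool_def if_False)
    then show ?thesis by (simp add: summand_def)
  qed
  then have nonpos: "0 \<le> - summand z" if "z \<in> ?P \<times> block_perms" for z
    using that by auto
  have in_sum: "(id, transpose 4 5) \<in> ?P \<times> block_perms"
    using transpose_in_block_perms[of 4 5] by (simp add: permutes_id)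
  have "0 < - summand (id, transpose 4 5)"
    by (simp add: summand_def F sign_swap_id)
  then have "0 < (\<Sum>z \<in> ?P \<times> block_perms. - summand z)"
    using in_sum nonpos by (intro sum_pos2[of _ "(id, transpose 4 5)"]) auto
  then have "(\<Sum>z \<in> ?P \<times> block_perms. summand z) < 0"
    by (simp add: sum_negf)
  then show ?thesis
    by (simp only: signed_sum_nested sum.cartesian_product F_def x_def summand_def)
qed

lemma dual_family_exists:
  assumes "dim (UNIV :: 'v::real_vector set) \<ge> CARD('n::finite)"
  shows "\<exists>(e :: 'n \<Rightarrow> 'v) c. (\<forall>i. linear (c i)) \<and> (\<forall>i j. c i (e j) = (of_bool (i = j) :: real))"
proof -
  obtain B :: "'v set" where B: "independent B" "UNIV \<subseteq> span B" "card B = dim (UNIV :: 'v set)"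
    using real_vector.basis_exists[of UNIV] by blast
  have "0 < CARD('n)" by simp
  then have "finite B"
    using assms B(3) by (metis card.infinite leD)
  then obtain e :: "'n \<Rightarrow> 'v" where e: "range e \<subseteq> B" "inj e"
    using card_le_inj[of "UNIV :: 'n set" B] assms B(3) by auto
  define c where "c i v = representation B v (e i)" for i v
  have "linear (c i)" for i
    unfolding c_def using B
    by (intro linearI) (simp_all add: real_vector.representation_add
      real_vector.representation_scale top.extremum_unique)
  moreover have "c i (e j) = of_bool (i = j)" for i j
    using e unfolding c_def
    by (subst real_vector.representation_basis[OF B(1)]) (auto dest: injD)
  ultimately show ?thesis by blast
qed

theorem proposition4p2:
  assumes "\<exists>B :: 'v::real_vector set. finite B \<and> span B = UNIV"
    and "dim (UNIV :: 'v set) \<ge> 8"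
  shows "\<exists>T \<in> (C4 :: ((8 \<Rightarrow> 'v) \<Rightarrow> real) set).
           (\<forall>x. antisymmetrize UNIV T x = 0) \<and>
           (\<exists>x. antisymmetrize {0, 1, 2, 3, 4} T x \<noteq> 0)"
proof -
  obtain e :: "8 \<Rightarrow> 'v" and c
    where c: "\<And>i. linear (c i)" and dual: "\<And>i j. c i (e j) = (of_bool (i = j) :: real)"
    using dual_family_exists[where 'n = 8 and 'v = 'v] assms(2) by auto
  define F where "F = tensor_product (\<lambda>k. c (labels k))"
  define T where "T = signed_sum block_perms F"
  have "T \<in> C4"
    unfolding T_def F_def
    by (intro signed_sum_block_perms_in_C4 multilinear_tensor_product c)
  moreover have "antisymmetrize UNIV T x = 0" for x
  proof -
    \<comment> \<open>positions \<open>0\<close> and \<open>4\<close> carry the same functional\<close>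
    have "F (y \<circ> transpose 0 4) = F y" for y
      unfolding F_def
      by (rule tensor_product_comp_invariant) (simp_all add: labels_def transpose_def)
    then have "signed_sum {p. bij p} F x = 0"
      by (intro signed_sum_invariant_eq_0[of "transpose 0 4"]) (simp_all add: sign_swap_id)
    then show ?thesis
      unfolding antisymmetrize_eq_signed_sum T_def
      by (simp add: permutes_UNIV_iff_bij signed_sum_signed_sum bij_block_perms)
  qed
  moreover have "antisymmetrize {0, 1, 2, 3, 4} T (\<lambda>k. e (labels (transpose 4 5 k))) \<noteq> 0"
    using five_fold_antisymmetrization_nonzero[of c e, OF dual]
    unfolding antisymmetrize_eq_signed_sum T_def F_def by simp
  ultimately show ?thesis by blast
qed

end
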